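(* Let $L$ be an odd positive integer, $N>1$ an integer, $w(y,y')\in\mathbb{C}$ for $y,y'\in\{0,\dots,L\}$ with $|y-y'|=1$. Let $\mathcal{K}_1$ be a finite index set, equipped with an arbitrary total order. Suppose that for each $k\in\mathcal{K}_1$ there are $\lambda_k\in\mathbb{C}$, column vectors $R^{o}_{k}$ (indexed by $\mathcal{S}^{o}_{L}$) and $R^{e}_{k}$ (indexed by $\mathcal{S}^{e}_{L}$), and row vectors $L^{o}_{k}$ (indexed by $\mathcal{S}^{o}_{L}$) and $L^{e}_{k}$ (indexed by $\mathcal{S}^{e}_{L}$) such that: (1) $\{R^{o}_k\}_{k\in\mathcal{K}_1}$ and $\{R^{e}_k\}_{k\in\mathcal{K}_1}$ are linearly independent, span $\mathbb{C}^{\mathcal{S}^{o}_{L}}$ and $\mathbb{C}^{\mathcal{S}^{e}_{L}}$ respectively, and $\mathbf{T}^{eo}_{1}R^{o}_{k}=\lambda_kR^{e}_{k}$, $\mathbf{T}^{oe}_{1}R^{e}_{k}=\lambda_kR^{o}_{k}$; (2) for each $p\in\{e,o\}$: $\sum_{y\in\mathcal{S}^p_L}\overline{L^{p}_{k}(y)}R^{p}_{k'}(y)=\delta_{k,k'}$ for all $k,k'\in\mathcal{K}_1$, and $\sum_{k\in\mathcal{K}_1}R^{p}_{k}(y)\overline{L^{p}_{k}(y')}=\delta_{y,y'}$ for all $y,y'\in\mathcal{S}^{p}_{L}$ (bar denotes complex conjugation); (3) $L^{o}_{k}\mathbf{T}^{oe}_{1}=\lambda_kL^{e}_{k}$ and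 $L^{e}_{k}\mathbf{T}^{eo}_{1}=\lambda_kL^{o}_{k}$. For ${\bf k}=(k_1,\dots,k_N)\in\mathcal{K}_N$ set $\Lambda_{\bf k}=\prod_{\alpha=1}^{N}\lambda_{k_\alpha}$, and for $C\in\{R,L\}$, $p\in\{e,o\}$, define the Bethe Ansatz vectors $$E^{p}_{C,{\bf k}}({\bf y})=\sum_{\sigma\in P_N}\epsilon_\sigma\prod_{\alpha=1}^{N}C^{p}_{k_{\sigma_\alpha}}(y_\alpha),\qquad {\bf y}\in\mathcal{U}^{p}_{L},$$ (so $E^{p}_{R,{\bf k}}$ is a column vector and $E^{p}_{L,{\bf k}}$ a row vector indexed by $\mathcal{U}^{p}_{L}$). Then: (a) $\mathbf{T}^{oe}_{N}E^{e}_{R,{\bf k}}=\Lambda_{\bf k}E^{o}_{R,{\bf k}}$ and $\mathbf{T}^{eo}_{N}E^{o}_{R,{\bf k}}=\Lambda_{\bf k}E^{e}_{R,{\bf k}}$ for all ${\bf k}\in\mathcal{K}_N$. (b)(i) $E^{o}_{R,{\bf k}}$ and $E^{e}_{R,{\bf k}}$ are right eigenvectors of $\mathbf{T}^{o\cdot o}_{N}$ and $\mathbf{T}^{e\cdot e}_{N}$ respectively, with eigenvalue $\Lambda_{\bf k}^2$; (ii) for each $p\in\{e,o\}$: $\sum_{{\bf y}\in\mathcal{U}^p_L}\overline{E^{p}_{L,{\bf k}}({\bf y})}E^{p}_{R,{\bf k}'}({\bf y})=\delta_{{\bf k},{\bf k}'}$ for all ${\bf k},{\bf k}'\in\mathcal{K}_N$,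 and $\sum_{{\bf k}\in\mathcal{K}_N}E^{p}_{R,{\bf k}}({\bf y})\overline{E^{p}_{L,{\bf k}}({\bf y}')}=\delta_{{\bf y},{\bf y}'}$ for all ${\bf y},{\bf y}'\in\mathcal{U}^{p}_{L}$; (iii) $E^{o}_{L,{\bf k}}\mathbf{T}^{oe}_{N}=\Lambda_{\bf k}E^{e}_{L,{\bf k}}$ and $E^{e}_{L,{\bf k}}\mathbf{T}^{eo}_{N}=\Lambda_{\bf k}E^{o}_{L,{\bf k}}$, and $E^{o}_{L,{\bf k}}$, $E^{e}_{L,{\bf k}}$ are left eigenvectors of $\mathbf{T}^{o\cdot o}_{N}$ and $\mathbf{T}^{e\cdot e}_{N}$ respectively with eigenvalue $\Lambda_{\bf k}^2$.
   Context: Notation: $\mathcal{S}^{o}_{L}$ is the set of odd integers in $[1,L]$, $\mathcal{S}^{e}_{L}$ the set of even integers in $[0,L]$; $\mathcal{U}^{p}_{L}=\{(y_1,\dots,y_N): y_1<\dots<y_N,\ y_j\in\mathcal{S}^{p}_{L}\}$ for $p\in\{e,o\}$. $\mathcal{K}_N=\{(k_1,\dots,k_N): k_j\in\mathcal{K}_1,\ k_1<\dots<k_N\}$. $P_N$ is the set of permutations $\sigma=(\sigma_1,\dots,\sigma_N)$ of $\{1,\dots,N\}$, $\epsilon_\sigma$ its sign. Transfer matrices: for $\{a,b\}=\{e,o\}$, $\mathbf{T}^{ab}_{1}$ has rows indexed by $\mathcal{S}^{a}_{L}$, columns by $\mathcal{S}^{b}_{L}$, entries $(\mathbf{T}^{ab}_{1})_{y,y'}=w(y,y')$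 if $|y-y'|=1$ and $0$ otherwise; $\mathbf{T}^{ab}_{N}$ has rows indexed by $\mathcal{U}^{a}_{L}$, columns by $\mathcal{U}^{b}_{L}$, entries $(\mathbf{T}^{ab}_{N})_{{\bf y},{\bf y}'}=\prod_{\alpha=1}^{N}(\mathbf{T}^{ab}_{1})_{y_\alpha,y'_\alpha}$. Two-step matrices: $\mathbf{T}^{e\cdot e}_{N}=\mathbf{T}^{eo}_{N}\mathbf{T}^{oe}_{N}$, $\mathbf{T}^{o\cdot o}_{N}=\mathbf{T}^{oe}_{N}\mathbf{T}^{eo}_{N}$. *)

theory Defs
  imports Complex_Main "HOL-Library.Function_Algebras" "HOL-Combinatorics.Permutations"
begin

datatype parity = Ev | Od

fun sites :: "int \<Rightarrow> parity \<Rightarrow> int set" where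
  "sites L Ev = {y. even y \<and> 0 \<le> y \<and> y \<le> L}"
| "sites L Od = {y. odd y \<and> 1 \<le> y \<and> y \<le> L}"

text \<open>Tuples are lists, so their positions are \<open>0, \<dots>, N - 1\<close>. This set serves both for the
  configurations of the walkers and for the index tuples of the Bethe vectors.\<close>

definition incr_tuples :: "nat \<Rightarrow> 'a::linorder set \<Rightarrow> 'a list set" where
  "incr_tuples N A = {xs. length xs = N \<and> sorted_wrt (<) xs \<and> set xs \<subseteq> A}"

abbreviation configs :: "nat \<Rightarrow> int \<Rightarrow> parity \<Rightarrow> int list set" where
  "configs N L p \<equiv> incr_tuples N (sites L p)"

text \<open>A vector or matrix with arbitrary index sets is a function of its indices. The index sets
  are not part of the function: those summed over are arguments of the products below, and
  equality of vectors is equality on the remaining index set.\<close>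

definition mat_vec :: "'j set \<Rightarrow> ('i \<Rightarrow> 'j \<Rightarrow> complex) \<Rightarrow> ('j \<Rightarrow> complex) \<Rightarrow> 'i \<Rightarrow> complex" where
  "mat_vec J A v i = (\<Sum>j\<in>J. A i j * v j)"

definition vec_mat :: "'i set \<Rightarrow> ('i \<Rightarrow> complex) \<Rightarrow> ('i \<Rightarrow> 'j \<Rightarrow> complex) \<Rightarrow> 'j \<Rightarrow> complex" where
  "vec_mat I v A j = (\<Sum>i\<in>I. v i * A i j)"

definition mat_mat ::
    "'j set \<Rightarrow> ('i \<Rightarrow> 'j \<Rightarrow> complex) \<Rightarrow> ('j \<Rightarrow> 'k \<Rightarrow> complex) \<Rightarrow> 'i \<Rightarrow> 'k \<Rightarrow> complex" where
  "mat_mat J A B i k = (\<Sum>j\<in>J. A i j * B j k)"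

definition right_eigenvector ::
    "'i set \<Rightarrow> ('i \<Rightarrow> 'i \<Rightarrow> complex) \<Rightarrow> ('i \<Rightarrow> complex) \<Rightarrow> complex \<Rightarrow> bool" where
  "right_eigenvector I A v \<mu> \<longleftrightarrow> (\<exists>i\<in>I. v i \<noteq> 0) \<and> (\<forall>i\<in>I. mat_vec I A v i = \<mu> * v i)"

definition left_eigenvector ::
    "'i set \<Rightarrow> ('i \<Rightarrow> 'i \<Rightarrow> complex) \<Rightarrow> ('i \<Rightarrow> complex) \<Rightarrow> complex \<Rightarrow> bool" where
  "left_eigenvector I A v \<mu> \<longleftrightarrow> (\<exists>i\<in>I. v i \<noteq> 0) \<and> (\<forall>i\<in>I. vec_mat I v A i = \<mu> * v i)"

text \<open>The space of complex vectors indexed by \<open>S\<close>, as functions vanishing off \<open>S\<close>; it is a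
  subspace of the complex vector space of all functions \<open>int \<Rightarrow> complex\<close>.\<close>

definition cvecs :: "int set \<Rightarrow> (int \<Rightarrow> complex) set" where
  "cvecs S = {f. \<forall>y. y \<notin> S \<longrightarrow> f y = 0}"

definition cscale :: "complex \<Rightarrow> (int \<Rightarrow> complex) \<Rightarrow> int \<Rightarrow> complex" where
  "cscale c f = (\<lambda>y. c * f y)"

global_interpretation cfun: vector_space cscale
  by unfold_locales (auto simp: cscale_def fun_eq_iff algebra_simps)

text \<open>The matrices \<open>T\<^sup>e\<^sup>o\<close> and \<open>T\<^sup>o\<^sup>e\<close> have the same entry formula and differ only
  in their index sets, hence a single function for both.\<close>

definition T1 :: "(int \<Rightarrow> int \<Rightarrow> complex) \<Rightarrow> int \<Rightarrow> int \<Rightarrow> complex" where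
  "T1 w y y' = (if \<bar>y - y'\<bar> = 1 then w y y' else 0)"

definition TN :: "nat \<Rightarrow> (int \<Rightarrow> int \<Rightarrow> complex) \<Rightarrow> int list \<Rightarrow> int list \<Rightarrow> complex" where
  "TN N w ys ys' = (\<Prod>\<alpha><N. T1 w (ys ! \<alpha>) (ys' ! \<alpha>))"

definition TN_ee :: "nat \<Rightarrow> int \<Rightarrow> (int \<Rightarrow> int \<Rightarrow> complex) \<Rightarrow> int list \<Rightarrow> int list \<Rightarrow> complex" where
  "TN_ee N L w = mat_mat (configs N L Od) (TN N w) (TN N w)"

definition TN_oo :: "nat \<Rightarrow> int \<Rightarrow> (int \<Rightarrow> int \<Rightarrow> complex) \<Rightarrow> int list \<Rightarrow> int list \<Rightarrow> complex" where
  "TN_oo N L w = mat_mat (configs N L Ev) (TN N w) (TN N w)"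

definition Lambda :: "nat \<Rightarrow> ('k \<Rightarrow> complex) \<Rightarrow> 'k list \<Rightarrow> complex" where
  "Lambda N lam ks = (\<Prod>\<alpha><N. lam (ks ! \<alpha>))"

definition bethe :: "nat \<Rightarrow> ('k \<Rightarrow> int \<Rightarrow> complex) \<Rightarrow> 'k list \<Rightarrow> int list \<Rightarrow> complex" where
  "bethe N C ks ys =
     (\<Sum>\<sigma> | \<sigma> permutes {..<N}. of_int (sign \<sigma>) * (\<Prod>\<alpha><N. C (ks ! \<sigma> \<alpha>) (ys ! \<alpha>)))"

end

theory Submission
  imports Defs
begin

text \<open>A Bethe vector is a minor of the matrix of one-particle eigenvectors. Walkers on sites of
  equal parity cannot cross in one step without meeting, so the entries of the \<open>N\<close>-particle
  transfer matrix are minors of the one-particle transfer matrix (Lindstroem, Gessel, Viennot).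
  Every identity of the theorem is then the Cauchy-Binet formula applied to the
  corresponding one-particle identity.\<close>

section \<open>Minors as signed sums over permutations\<close>

text \<open>This is the Leibniz formula for the determinant with entries
  \<open>A (xs ! i) (ys ! j)\<close>, \<open>i, j < N\<close>. Rows and columns are selected by
  lists over arbitrary types, so that sites and spectral indices can stand on either side.\<close>

definition minor :: "nat \<Rightarrow> ('a \<Rightarrow> 'b \<Rightarrow> complex) \<Rightarrow> 'a list \<Rightarrow> 'b list \<Rightarrow> complex" where
  "minor N A xs ys =
     (\<Sum>\<sigma> | \<sigma> permutes {..<N}. of_int (sign \<sigma>) * (\<Prod>\<alpha><N. A (xs ! \<sigma> \<alpha>) (ys ! \<alpha>)))"

lemma finite_permutes_lessThan: "finite {\<sigma>. \<sigma> permutes {..<N::nat}}"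
  by (simp add: finite_permutations)

lemma permutes_less: "\<sigma> permutes {..<N::nat} \<Longrightarrow> \<alpha> < N \<Longrightarrow> \<sigma> \<alpha> < N"
  using permutes_in_image[of \<sigma> "{..<N}" \<alpha>] by simp

lemma permutes_imp_permutation: "\<sigma> permutes {..<N::nat} \<Longrightarrow> permutation \<sigma>"
  using permutation_permutes by blast

lemma sign_inv_permutes: "\<sigma> permutes {..<N::nat} \<Longrightarrow> sign (inv \<sigma>) = sign \<sigma>"
  by (rule sign_inverse) (rule permutes_imp_permutation)

text \<open>Replacing \<sigma> by \<open>\<sigma> \<circ> \<tau>\<close> splits off the sign of
  \<tau>, and reindexing the product along \<tau> removes \<tau> from it. The columns are chosen by
  a function \<open>f\<close>, not by an increasing list, because Cauchy-Binet expands over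
  arbitrary maps.\<close>

lemma sum_sign_permuted_columns:
  fixes g :: "nat \<Rightarrow> 'b \<Rightarrow> complex"
  assumes \<tau>: "\<tau> permutes {..<N}"
  shows "(\<Sum>\<sigma> | \<sigma> permutes {..<N}. of_int (sign \<sigma>) * (\<Prod>\<alpha><N. g (\<sigma> \<alpha>) (f (\<tau> \<alpha>))))
       = of_int (sign \<tau>) *
         (\<Sum>\<sigma> | \<sigma> permutes {..<N}. of_int (sign \<sigma>) * (\<Prod>\<alpha><N. g (\<sigma> \<alpha>) (f \<alpha>)))"
proof -
  have "(\<Sum>\<sigma> | \<sigma> permutes {..<N}. of_int (sign \<sigma>) * (\<Prod>\<alpha><N. g (\<sigma> \<alpha>) (f (\<tau> \<alpha>))))
      = (\<Sum>\<sigma> | \<sigma> permutes {..<N}. of_int (sign (\<sigma> \<circ> \<tau>)) * (\<Prod>\<alpha><N. g ((\<sigma> \<circ> \<tau>) \<alpha>) (f (\<tau> \<alpha>))))"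
    by (rule sum_permutations_compose_right[OF \<tau>])
  also have "\<dots> = (\<Sum>\<sigma> | \<sigma> permutes {..<N}.
      of_int (sign \<tau>) * (of_int (sign \<sigma>) * (\<Prod>\<alpha><N. g (\<sigma> \<alpha>) (f \<alpha>))))"
  proof (rule sum.cong[OF refl])
    fix \<sigma> assume "\<sigma> \<in> {\<sigma>. \<sigma> permutes {..<N}}"
    then have "sign (\<sigma> \<circ> \<tau>) = sign \<sigma> * sign \<tau>"
      using \<tau> by (intro sign_compose) (auto intro: permutes_imp_permutation)
    moreover have "(\<Prod>\<alpha><N. g ((\<sigma> \<circ> \<tau>) \<alpha>) (f (\<tau> \<alpha>))) = (\<Prod>\<alpha><N. g (\<sigma> \<alpha>) (f \<alpha>))"
      using prod.permute[OF \<tau>, of "\<lambda>\<alpha>. g (\<sigma> \<alpha>) (f \<alpha>)"] by (simp add: o_def)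
    ultimately show "of_int (sign (\<sigma> \<circ> \<tau>)) * (\<Prod>\<alpha><N. g ((\<sigma> \<circ> \<tau>) \<alpha>) (f (\<tau> \<alpha>)))
      = of_int (sign \<tau>) * (of_int (sign \<sigma>) * (\<Prod>\<alpha><N. g (\<sigma> \<alpha>) (f \<alpha>)))"
      by simp
  qed
  finally show ?thesis by (simp add: sum_distrib_left)
qed

text \<open>Transposing two positions with the same column changes nothing in the sum but reverses
  its sign, so the sum is its own negative.\<close>

lemma sum_sign_repeated_column:
  fixes g :: "nat \<Rightarrow> 'b \<Rightarrow> complex"
  assumes "\<not> inj_on f {..<N}"
  shows "(\<Sum>\<sigma> | \<sigma> permutes {..<N}. of_int (sign \<sigma>) * (\<Prod>\<alpha><N. g (\<sigma> \<alpha>) (f \<alpha>))) = 0"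
    (is "?D = 0")
proof -
  obtain a b where ab: "a < N" "b < N" "a \<noteq> b" "f a = f b"
    using assms by (auto simp: inj_on_def)
  have "transpose a b permutes {..<N}"
    using ab by (intro permutes_swap_id) auto
  from sum_sign_permuted_columns[OF this, of g f] have
    "(\<Sum>\<sigma> | \<sigma> permutes {..<N}. of_int (sign \<sigma>) * (\<Prod>\<alpha><N. g (\<sigma> \<alpha>) (f (transpose a b \<alpha>)))) = - ?D"
    using ab by (simp add: sign_swap_id)
  moreover have "f (transpose a b \<alpha>) = f \<alpha>" for \<alpha>
    using ab by (auto simp: transpose_def)
  ultimately have "?D = - ?D"
    by simp
  then show ?thesis
    by simp
qed

text \<open>The substitution of \<open>inv \<sigma>\<close> for \<sigma> preserves signs, and
  reindexing the product along \<sigma> moves the permutation from the columns to the rows.\<close>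

lemma minor_transpose: "minor N A xs ys = minor N (\<lambda>y x. A x y) ys xs"
proof -
  have "minor N (\<lambda>y x. A x y) ys xs =
      (\<Sum>\<sigma> | \<sigma> permutes {..<N}. of_int (sign (inv \<sigma>)) * (\<Prod>\<alpha><N. A (xs ! \<alpha>) (ys ! inv \<sigma> \<alpha>)))"
    unfolding minor_def by (rule sum_permutations_inverse)
  also have "\<dots> = minor N A xs ys"
    unfolding minor_def
  proof (rule sum.cong[OF refl])
    fix \<sigma> assume "\<sigma> \<in> {\<sigma>. \<sigma> permutes {..<N}}"
    then have \<sigma>: "\<sigma> permutes {..<N}" by simp
    have "(\<Prod>\<alpha><N. A (xs ! \<alpha>) (ys ! inv \<sigma> \<alpha>)) = (\<Prod>\<alpha><N. A (xs ! \<sigma> \<alpha>) (ys ! \<alpha>))"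
      using prod.permute[OF \<sigma>, of "\<lambda>\<alpha>. A (xs ! \<alpha>) (ys ! inv \<sigma> \<alpha>)"]
      by (simp add: o_def permutes_inverses[OF \<sigma>])
    then show "of_int (sign (inv \<sigma>)) * (\<Prod>\<alpha><N. A (xs ! \<alpha>) (ys ! inv \<sigma> \<alpha>)) =
        of_int (sign \<sigma>) * (\<Prod>\<alpha><N. A (xs ! \<sigma> \<alpha>) (ys ! \<alpha>))"
      by (simp add: sign_inv_permutes[OF \<sigma>])
  qed
  finally show ?thesis by simp
qed

text \<open>One-particle identities are given only on their index sets. A permutation of the
  positions never leaves the lists, so no other entries occur in a minor.\<close>

lemma minor_cong:
  assumes "xs \<in> incr_tuples N S" "ys \<in> incr_tuples N S'"
    and "\<And>x y. x \<in> S \<Longrightarrow> y \<in> S' \<Longrightarrow> A x y = B x y"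
  shows "minor N A xs ys = minor N B xs ys"
proof -
  have "A (xs ! \<sigma> \<alpha>) (ys ! \<alpha>) = B (xs ! \<sigma> \<alpha>) (ys ! \<alpha>)" if "\<sigma> permutes {..<N}" "\<alpha> < N" for \<sigma> \<alpha>
    using assms(1,2) permutes_less[OF that] that(2)
    by (intro assms(3)) (auto simp: incr_tuples_def)
  then show ?thesis
    unfolding minor_def by (intro sum.cong refl arg_cong2[where f="(*)"] prod.cong) auto
qed

text \<open>Each term of the expansion uses every row exactly once, so the row factors form a common
  product. This is how \<open>Lambda\<close> arises from the one-particle eigenvalues.\<close>

lemma minor_scale_rows:
  "minor N (\<lambda>x y. l x * A x y) xs ys = (\<Prod>\<alpha><N. l (xs ! \<alpha>)) * minor N A xs ys"
proof -
  have "(\<Prod>\<alpha><N. l (xs ! \<sigma> \<alpha>)) = (\<Prod>\<alpha><N. l (xs ! \<alpha>))" if "\<sigma> permutes {..<N}" for \<sigma>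
    using prod.permute[OF that, of "\<lambda>\<alpha>. l (xs ! \<alpha>)"] by (simp add: o_def)
  then show ?thesis
    unfolding minor_def by (simp add: prod.distrib sum_distrib_left mult_ac)
qed

lemma cnj_minor: "cnj (minor N A xs ys) = minor N (\<lambda>x y. cnj (A x y)) xs ys"
  unfolding minor_def by simp

lemma bethe_eq_minor: "bethe N C ks ys = minor N C ks ys"
  unfolding bethe_def minor_def ..

section \<open>Increasing tuples and minors of the identity matrix\<close>

lemma incr_tuples_eqI:
  "xs \<in> incr_tuples N A \<Longrightarrow> ys \<in> incr_tuples N B \<Longrightarrow> set xs = set ys \<Longrightarrow> xs = ys"
  by (auto simp: incr_tuples_def intro: strict_sorted_equal)

lemma incr_tuples_distinct: "xs \<in> incr_tuples N A \<Longrightarrow> distinct xs"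
  by (auto simp: incr_tuples_def strict_sorted_iff)

text \<open>A nonzero term matches every entry of \<open>ys\<close> with one of \<open>xs\<close>.
  The two tuples then have the same set of entries, hence agree because they are increasing, and
  distinctness of the entries leaves only the identity permutation.\<close>

lemma minor_delta:
  assumes xs: "xs \<in> incr_tuples N A" and ys: "ys \<in> incr_tuples N A"
  shows "minor N (\<lambda>x y. if x = y then 1 else 0) xs ys = (if xs = ys then 1 else 0)"
proof -
  have len: "length xs = N" "length ys = N"
    using xs ys by (auto simp: incr_tuples_def)
  have prod0: "(\<Prod>\<alpha><N. if xs ! \<sigma> \<alpha> = ys ! \<alpha> then 1 else 0 :: complex) = 0"
    if \<sigma>: "\<sigma> permutes {..<N}" and ne: "\<not> (xs = ys \<and> \<sigma> = id)" for \<sigma>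
  proof (rule ccontr)
    assume "\<not> ?thesis"
    then have eq: "xs ! \<sigma> \<alpha> = ys ! \<alpha>" if "\<alpha> < N" for \<alpha>
      using that by (auto split: if_splits)
    have "set ys = (\<lambda>\<alpha>. xs ! \<sigma> \<alpha>) ` {..<N}"
      using eq len by (auto simp: set_conv_nth)
    also have "\<dots> = (!) xs ` {..<N}"
      using permutes_image[OF \<sigma>] by (metis image_image)
    also have "\<dots> = set xs"
      using len by (auto simp: set_conv_nth)
    finally have "xs = ys"
      by (intro incr_tuples_eqI[OF xs ys]) simp
    moreover have "\<sigma> \<alpha> = \<alpha>" for \<alpha>
    proof (cases "\<alpha> < N")
      case True
      then show ?thesis
        using eq[OF True] \<open>xs = ys\<close> incr_tuples_distinct[OF xs] permutes_less[OF \<sigma> True] len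
        by (auto simp: nth_eq_iff_index_eq)
    next
      case False
      then show ?thesis using permutes_not_in[OF \<sigma>] by simp
    qed
    ultimately show False using ne by auto
  qed
  show ?thesis
  proof (cases "xs = ys")
    case True
    have "minor N (\<lambda>x y. if x = y then 1 else 0) xs ys =
        (\<Sum>\<sigma>\<in>{id}. of_int (sign \<sigma>) * (\<Prod>\<alpha><N. if xs ! \<sigma> \<alpha> = ys ! \<alpha> then 1 else 0 :: complex))"
      unfolding minor_def
      by (rule sum.mono_neutral_right)
        (auto simp: finite_permutes_lessThan permutes_id intro!: prod0 simp del: prod_zero_iff)
    then show ?thesis using True by (simp add: sign_id)
  next
    case False
    then show ?thesis
      unfolding minor_def by (auto intro!: sum.neutral prod0 simp del: prod_zero_iff)
  qed
qed

section \<open>The Cauchy-Binet formula\<close>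

text \<open>An injective map on the positions amounts to its sorted image together with the
  permutation that restores the original order. The restriction makes the maps extensional, as are
  those that index the expansion of a product of sums.\<close>

lemma bij_betw_incr_tuples_permutes:
  fixes S :: "'a::linorder set"
  shows "bij_betw (\<lambda>(zs, \<tau>). restrict (\<lambda>\<alpha>. zs ! \<tau> \<alpha>) {..<N})
     (incr_tuples N S \<times> {\<tau>. \<tau> permutes {..<N}})
     {f \<in> {..<N} \<rightarrow>\<^sub>E S. inj_on f {..<N}}"
    (is "bij_betw ?F _ _")
proof -
  have img: "(\<lambda>\<alpha>. zs ! \<tau> \<alpha>) ` {..<N} = set zs"
    if "zs \<in> incr_tuples N S" "\<tau> permutes {..<N}" for zs \<tau>
  proof -
    have "(\<lambda>\<alpha>. zs ! \<tau> \<alpha>) ` {..<N} = (!) zs ` {..<N}"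
      using permutes_image[OF that(2)] by (metis image_image)
    then show ?thesis
      using that(1) by (auto simp: set_conv_nth incr_tuples_def)
  qed
  have inj: "inj_on ?F (incr_tuples N S \<times> {\<tau>. \<tau> permutes {..<N}})"
  proof (rule inj_onI, clarify)
    fix zs \<tau> zs' \<tau>'
    assume zs: "zs \<in> incr_tuples N S" and zs': "zs' \<in> incr_tuples N S"
      and \<tau>: "\<tau> permutes {..<N}" and \<tau>': "\<tau>' permutes {..<N}"
      and "restrict (\<lambda>\<alpha>. zs ! \<tau> \<alpha>) {..<N} = restrict (\<lambda>\<alpha>. zs' ! \<tau>' \<alpha>) {..<N}"
    then have eq: "zs ! \<tau> \<alpha> = zs' ! \<tau>' \<alpha>" if "\<alpha> < N" for \<alpha>
      using that by (metis lessThan_iff restrict_apply')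
    \<comment> \<open>The range of the map already determines the sorted list; only afterwards can
      the permutations be compared.\<close>
    then have "(\<lambda>\<alpha>. zs ! \<tau> \<alpha>) ` {..<N} = (\<lambda>\<alpha>. zs' ! \<tau>' \<alpha>) ` {..<N}"
      by (intro image_cong) auto
    then have "zs = zs'"
      using img[OF zs \<tau>] img[OF zs' \<tau>'] by (intro incr_tuples_eqI[OF zs zs']) simp
    moreover have "\<tau> \<alpha> = \<tau>' \<alpha>" for \<alpha>
    proof (cases "\<alpha> < N")
      case True
      then show ?thesis
        using eq[OF True] \<open>zs = zs'\<close> incr_tuples_distinct[OF zs] zs
          permutes_less[OF \<tau> True] permutes_less[OF \<tau>' True]
        by (auto simp: nth_eq_iff_index_eq incr_tuples_def)
    next
      case False
      then show ?thesis using permutes_not_in[OF \<tau>] permutes_not_in[OF \<tau>'] by simp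
    qed
    ultimately show "zs = zs' \<and> \<tau> = \<tau>'" by auto
  qed
  have into: "?F (zs, \<tau>) \<in> {f \<in> {..<N} \<rightarrow>\<^sub>E S. inj_on f {..<N}}"
    if zs: "zs \<in> incr_tuples N S" and \<tau>: "\<tau> permutes {..<N}" for zs \<tau>
  proof -
    have "zs ! \<tau> \<alpha> \<in> S" if "\<alpha> < N" for \<alpha>
      using zs permutes_less[OF \<tau> that] by (auto simp: incr_tuples_def)
    moreover have "inj_on (\<lambda>\<alpha>. zs ! \<tau> \<alpha>) {..<N}"
    proof (rule inj_onI)
      fix a b assume ab: "a \<in> {..<N}" "b \<in> {..<N}" "zs ! \<tau> a = zs ! \<tau> b"
      then have "\<tau> a = \<tau> b"
        using incr_tuples_distinct[OF zs] zs permutes_less[OF \<tau>]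
        by (auto simp: nth_eq_iff_index_eq incr_tuples_def)
      then show "a = b" using permutes_inj[OF \<tau>] by (auto dest: injD)
    qed
    ultimately show ?thesis by (auto simp: inj_on_def)
  qed
  have onto: "\<exists>zs \<tau>. zs \<in> incr_tuples N S \<and> \<tau> permutes {..<N} \<and> f = ?F (zs, \<tau>)"
    if f: "f \<in> {..<N} \<rightarrow>\<^sub>E S" "inj_on f {..<N}" for f
  proof -
    define zs where "zs = sorted_list_of_set (f ` {..<N})"
    have set: "set zs = f ` {..<N}" and dist: "distinct zs" and len: "length zs = N"
      using card_image[OF f(2)] by (auto simp: zs_def)
    have zs: "zs \<in> incr_tuples N S"
      using f(1) set len by (auto simp: incr_tuples_def zs_def)
    have nth: "bij_betw ((!) zs) {..<N} (f ` {..<N})"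
      using bij_betw_nth[OF dist] len set by simp
    \<comment> \<open>\<open>\<tau> \<alpha>\<close> is the position of \<open>f \<alpha>\<close> in
      the sorted list \<open>zs\<close>. From \<open>N\<close> on it is the identity, as
      \<open>permutes\<close> demands.\<close>
    define \<tau> where "\<tau> \<alpha> = (if \<alpha> < N then inv_into {..<N} ((!) zs) (f \<alpha>) else \<alpha>)" for \<alpha>
    have "bij_betw (inv_into {..<N} ((!) zs) \<circ> f) {..<N} {..<N}"
      using bij_betw_trans[OF inj_on_imp_bij_betw[OF f(2)] bij_betw_inv_into[OF nth]] .
    then have "bij_betw \<tau> {..<N} {..<N}"
      by (rule bij_betw_cong[THEN iffD1, rotated]) (auto simp: \<tau>_def)
    then have "\<tau> permutes {..<N}"
      by (rule bij_imp_permutes) (auto simp: \<tau>_def)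
    moreover have "zs ! \<tau> \<alpha> = f \<alpha>" if "\<alpha> < N" for \<alpha>
      using that bij_betw_inv_into_right[OF nth, of "f \<alpha>"] by (simp add: \<tau>_def)
    \<comment> \<open>Outside \<open>{..<N}\<close> both sides are \<open>undefined\<close>, since
      \<open>f\<close> is extensional.\<close>
    then have "f = ?F (zs, \<tau>)"
      using f(1) by (intro ext) (auto simp: PiE_arb[OF f(1)])
    ultimately show ?thesis using zs by blast
  qed
  show ?thesis
    unfolding bij_betw_def
  proof (intro conjI inj equalityI subsetI)
    fix f assume "f \<in> ?F ` (incr_tuples N S \<times> {\<tau>. \<tau> permutes {..<N}})"
    then obtain zs \<tau> where "zs \<in> incr_tuples N S" "\<tau> permutes {..<N}" "f = ?F (zs, \<tau>)"
      by blast
    then show "f \<in> {f \<in> {..<N} \<rightarrow>\<^sub>E S. inj_on f {..<N}}"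
      using into by blast
  next
    fix f assume "f \<in> {f \<in> {..<N} \<rightarrow>\<^sub>E S. inj_on f {..<N}}"
    then obtain zs \<tau> where "zs \<in> incr_tuples N S" "\<tau> permutes {..<N}" "f = ?F (zs, \<tau>)"
      using onto by blast
    then show "f \<in> ?F ` (incr_tuples N S \<times> {\<tau>. \<tau> permutes {..<N}})"
      by blast
  qed
qed

text \<open>Multiplying out the product of sums gives a sum over all maps from positions to
  \<open>S\<close>. Maps with a repeated value cancel, and the injective ones are grouped by their
  sorted image.\<close>

theorem Cauchy_Binet_minor:
  fixes S :: "'a::linorder set"
  assumes "finite S"
  shows "(\<Sum>zs\<in>incr_tuples N S. minor N A xs zs * minor N B zs ys)
       = minor N (\<lambda>x y. \<Sum>z\<in>S. A x z * B z y) xs ys"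
proof -
  let ?P = "{\<sigma>. \<sigma> permutes {..<N}}"
  \<comment> \<open>\<open>D f\<close> gathers all that depends on \<sigma>: it is the determinant
    whose columns are chosen by \<open>f\<close>. The factor \<open>b f\<close> is free of
    \<sigma>.\<close>
  define D where "D f = (\<Sum>\<sigma>\<in>?P. of_int (sign \<sigma>) * (\<Prod>\<alpha><N. A (xs ! \<sigma> \<alpha>) (f \<alpha>)))" for f
  define b where "b f = (\<Prod>\<alpha><N. B (f \<alpha>) (ys ! \<alpha>))" for f :: "nat \<Rightarrow> 'a"
  have finE: "finite ({..<N} \<rightarrow>\<^sub>E S)"
    using assms by (simp add: finite_PiE)
  \<comment> \<open>Sorting the columns of \<open>D\<close> costs the sign of \<tau>, which is
    exactly the sign that the expansion of the second minor needs.\<close>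
  have summand: "D (restrict (\<lambda>\<alpha>. zs ! \<tau> \<alpha>) {..<N}) * b (restrict (\<lambda>\<alpha>. zs ! \<tau> \<alpha>) {..<N}) =
      minor N A xs zs * (of_int (sign \<tau>) * (\<Prod>\<alpha><N. B (zs ! \<tau> \<alpha>) (ys ! \<alpha>)))"
    if "\<tau> permutes {..<N}" for zs \<tau>
    using sum_sign_permuted_columns[OF that, of "\<lambda>i. A (xs ! i)" "\<lambda>\<alpha>. zs ! \<alpha>"]
    by (simp add: D_def b_def minor_def)
  have "minor N (\<lambda>x y. \<Sum>z\<in>S. A x z * B z y) xs ys =
      (\<Sum>\<sigma>\<in>?P. of_int (sign \<sigma>) *
        (\<Sum>f\<in>{..<N} \<rightarrow>\<^sub>E S. \<Prod>\<alpha><N. A (xs ! \<sigma> \<alpha>) (f \<alpha>) * B (f \<alpha>) (ys ! \<alpha>)))"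
    unfolding minor_def using assms by (subst prod_sum_PiE) auto
  also have "\<dots> = (\<Sum>f\<in>{..<N} \<rightarrow>\<^sub>E S. D f * b f)"
    unfolding D_def b_def sum_distrib_left sum_distrib_right prod.distrib
    by (subst sum.swap) (simp add: mult_ac)
  \<comment> \<open>A map that repeats a value gives \<open>D f\<close> two equal columns.\<close>
  also have "\<dots> = (\<Sum>f | f \<in> {..<N} \<rightarrow>\<^sub>E S \<and> inj_on f {..<N}. D f * b f)"
    using finE sum_sign_repeated_column[of _ N "\<lambda>i. A (xs ! i)"]
    by (intro sum.mono_neutral_right) (auto simp: D_def)
  also have "\<dots> = (\<Sum>(zs, \<tau>)\<in>incr_tuples N S \<times> ?P.
      D (restrict (\<lambda>\<alpha>. zs ! \<tau> \<alpha>) {..<N}) * b (restrict (\<lambda>\<alpha>. zs ! \<tau> \<alpha>) {..<N}))"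
    by (subst sum.reindex_bij_betw[OF bij_betw_incr_tuples_permutes, symmetric])
      (simp add: case_prod_beta)
  also have "\<dots> = (\<Sum>(zs, \<tau>)\<in>incr_tuples N S \<times> ?P.
      minor N A xs zs * (of_int (sign \<tau>) * (\<Prod>\<alpha><N. B (zs ! \<tau> \<alpha>) (ys ! \<alpha>))))"
    by (intro sum.cong refl) (auto simp: summand)
  also have "\<dots> = (\<Sum>zs\<in>incr_tuples N S. minor N A xs zs * minor N B zs ys)"
    by (simp add: sum.cartesian_product[symmetric] sum_distrib_left[symmetric] minor_def[of N B])
  finally show ?thesis ..
qed

section \<open>Non-crossing walkers and the transfer matrix\<close>

text \<open>Take the least moved point \<open>a\<close>. All smaller points are fixed, so by
  injectivity both \<open>\<sigma> a\<close> and the preimage \<open>b\<close> of \<open>a\<close>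
  exceed \<open>a\<close>; hence \<sigma> inverts \<open>a\<close> and \<open>b\<close>.\<close>

lemma permutes_non_id_inversion:
  fixes \<sigma> :: "nat \<Rightarrow> nat"
  assumes \<sigma>: "\<sigma> permutes {..<N}" and "\<sigma> \<noteq> id"
  obtains a b where "a < b" "b < N" "\<sigma> b < \<sigma> a"
proof -
  define a where "a = (LEAST a. \<sigma> a \<noteq> a)"
  have "\<exists>a. \<sigma> a \<noteq> a" using assms(2) by (auto simp: fun_eq_iff)
  then have a: "\<sigma> a \<noteq> a" unfolding a_def by (rule LeastI_ex)
  have fix_below: "\<sigma> c = c" if "c < a" for c
    using not_less_Least[of c "\<lambda>a. \<sigma> a \<noteq> a"] that unfolding a_def by blast
  have inj: "\<sigma> x = \<sigma> y \<Longrightarrow> x = y" for x y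
    using permutes_inj[OF \<sigma>] by (auto dest: injD)
  obtain b where b: "\<sigma> b = a"
    using permutes_surj[OF \<sigma>] by (metis surjD)
  have "a < \<sigma> a"
    using a fix_below inj by (metis linorder_neqE_nat)
  moreover have "a < b"
    using a b fix_below by (metis linorder_neqE_nat)
  moreover have "b < N"
    using b \<open>a < b\<close> permutes_not_in[OF \<sigma>, of b] by force
  ultimately show ?thesis using that b by metis
qed

lemma finite_sites: "finite (sites L p)"
  by (rule finite_subset[of _ "{0..L}"]) (cases p; auto)+

lemma sites_gap: "x \<in> sites L p \<Longrightarrow> y \<in> sites L p \<Longrightarrow> x < y \<Longrightarrow> x + 2 \<le> y"
  by (cases p) (auto elim!: evenE oddE, presburger)

text \<open>The identity permutation contributes the product that defines \<open>TN\<close>. Any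
  other permutation has an inversion, hence makes two walkers cross, and its product contains a zero
  factor.\<close>

lemma TN_eq_minor:
  assumes xs: "xs \<in> configs N L p" and ys: "ys \<in> configs N L q"
  shows "TN N w xs ys = minor N (T1 w) xs ys"
proof -
  have crossing: "(\<Prod>\<alpha><N. T1 w (xs ! \<sigma> \<alpha>) (ys ! \<alpha>)) = 0"
    if \<sigma>: "\<sigma> permutes {..<N}" and "\<sigma> \<noteq> id" for \<sigma>
  proof -
    obtain a b where ab: "a < b" "b < N" "\<sigma> b < \<sigma> a"
      using permutes_non_id_inversion[OF \<sigma> \<open>\<sigma> \<noteq> id\<close>] by blast
    have gap: "zs ! i + 2 \<le> zs ! j" if "zs \<in> configs N L r" "i < j" "j < N" for zs r i j
      using that
      by (intro sites_gap[of _ L r]) (auto simp: incr_tuples_def sorted_wrt_iff_nth_less)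
    have "ys ! a + 2 \<le> ys ! b"
      using gap[OF ys] ab by simp
    moreover have "xs ! \<sigma> b + 2 \<le> xs ! \<sigma> a"
      using gap[OF xs] ab permutes_less[OF \<sigma>, of a] by simp
    \<comment> \<open>If both entries were nonzero, two unit steps would take a difference of at
      least 2 to one of at most -2, but they change it by at most 2.\<close>
    ultimately have "T1 w (xs ! \<sigma> a) (ys ! a) = 0 \<or> T1 w (xs ! \<sigma> b) (ys ! b) = 0"
      by (auto simp: T1_def)
    moreover have "a \<in> {..<N}" "b \<in> {..<N}" using ab by auto
    ultimately show ?thesis by (auto intro: prod_zero)
  qed
  have "minor N (T1 w) xs ys =
      (\<Sum>\<sigma>\<in>{id}. of_int (sign \<sigma>) * (\<Prod>\<alpha><N. T1 w (xs ! \<sigma> \<alpha>) (ys ! \<alpha>)))"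
    unfolding minor_def
    by (rule sum.mono_neutral_right)
      (auto simp: finite_permutes_lessThan permutes_id crossing simp del: prod_zero_iff)
  then show ?thesis by (simp add: TN_def sign_id)
qed

section \<open>Bethe vectors: transfer matrices, orthonormality, completeness\<close>

text \<open>Cauchy-Binet sums over the columns of the first factor and the rows of the second, so
  the Bethe minor is transposed to have configurations as rows. Transposing back makes the
  eigenvalues row factors. \<open>C\<close> and \<open>C'\<close> differ because one step changes
  the parity of the sites.\<close>

lemma mat_vec_TN_bethe:
  assumes ks: "ks \<in> incr_tuples N K" and xs: "xs \<in> configs N L p"
    and step: "\<And>k y. k \<in> K \<Longrightarrow> y \<in> sites L p \<Longrightarrow>
      mat_vec (sites L q) (T1 w) (C k) y = lam k * C' k y"
  shows "mat_vec (configs N L q) (TN N w) (bethe N C ks) xs = Lambda N lam ks * bethe N C' ks xs"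
proof -
  have "mat_vec (configs N L q) (TN N w) (bethe N C ks) xs =
      (\<Sum>ys\<in>configs N L q. minor N (T1 w) xs ys * minor N (\<lambda>y k. C k y) ys ks)"
    unfolding mat_vec_def bethe_eq_minor
    by (intro sum.cong refl) (simp add: TN_eq_minor[OF xs] minor_transpose[of N C])
  also have "\<dots> = minor N (\<lambda>y k. \<Sum>z\<in>sites L q. T1 w y z * C k z) xs ks"
    by (rule Cauchy_Binet_minor[OF finite_sites])
  also have "\<dots> = minor N (\<lambda>y k. lam k * C' k y) xs ks"
    by (rule minor_cong[OF xs ks]) (use step in \<open>simp add: mat_vec_def\<close>)
  also have "\<dots> = minor N (\<lambda>k y. lam k * C' k y) ks xs"
    by (rule minor_transpose)
  finally show ?thesis
    by (simp add: minor_scale_rows Lambda_def bethe_eq_minor)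
qed

text \<open>Here the Bethe minor is the left factor and its columns are already the configurations,
  so Cauchy-Binet applies without transposition.\<close>

lemma vec_mat_TN_bethe:
  assumes ks: "ks \<in> incr_tuples N K" and xs: "xs \<in> configs N L p"
    and step: "\<And>k y. k \<in> K \<Longrightarrow> y \<in> sites L p \<Longrightarrow>
      vec_mat (sites L q) (C k) (T1 w) y = lam k * C' k y"
  shows "vec_mat (configs N L q) (bethe N C ks) (TN N w) xs = Lambda N lam ks * bethe N C' ks xs"
proof -
  have "vec_mat (configs N L q) (bethe N C ks) (TN N w) xs =
      (\<Sum>ys\<in>configs N L q. minor N C ks ys * minor N (T1 w) ys xs)"
    unfolding vec_mat_def bethe_eq_minor
    by (intro sum.cong refl) (simp add: TN_eq_minor[OF _ xs])
  also have "\<dots> = minor N (\<lambda>k y. \<Sum>z\<in>sites L q. C k z * T1 w z y) ks xs"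
    by (rule Cauchy_Binet_minor[OF finite_sites])
  also have "\<dots> = minor N (\<lambda>k y. lam k * C' k y) ks xs"
    by (rule minor_cong[OF ks xs]) (use step in \<open>simp add: vec_mat_def\<close>)
  finally show ?thesis
    by (simp add: minor_scale_rows Lambda_def bethe_eq_minor)
qed

text \<open>Conjugation passes into the entries of the minor. By Cauchy-Binet the pairing is then
  the minor of the one-particle pairing, which is the identity matrix on \<open>K\<close>.\<close>

lemma bethe_orthonormal:
  assumes ks: "ks \<in> incr_tuples N K" and ks': "ks' \<in> incr_tuples N K"
    and orth: "\<And>k k'. k \<in> K \<Longrightarrow> k' \<in> K \<Longrightarrow>
      (\<Sum>y\<in>sites L p. cnj (C k y) * C' k' y) = (if k = k' then 1 else 0)"
  shows "(\<Sum>ys\<in>configs N L p. cnj (bethe N C ks ys) * bethe N C' ks' ys) = (if ks = ks' then 1 else 0)"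
proof -
  have "(\<Sum>ys\<in>configs N L p. cnj (bethe N C ks ys) * bethe N C' ks' ys) =
      (\<Sum>ys\<in>configs N L p. minor N (\<lambda>k y. cnj (C k y)) ks ys * minor N (\<lambda>y k. C' k y) ys ks')"
    by (simp add: bethe_eq_minor cnj_minor minor_transpose[of N C'])
  also have "\<dots> = minor N (\<lambda>k k'. \<Sum>y\<in>sites L p. cnj (C k y) * C' k' y) ks ks'"
    by (rule Cauchy_Binet_minor[OF finite_sites])
  also have "\<dots> = minor N (\<lambda>k k'. if k = k' then 1 else 0) ks ks'"
    by (rule minor_cong[OF ks ks' orth])
  finally show ?thesis by (simp add: minor_delta[OF ks ks'])
qed

text \<open>The same argument with the roles exchanged: \<open>K\<close> is the set summed over, and
  the sites index the identity matrix.\<close>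

lemma bethe_complete:
  assumes "finite K" and ys: "ys \<in> configs N L p" and ys': "ys' \<in> configs N L p"
    and complete: "\<And>y y'. y \<in> sites L p \<Longrightarrow> y' \<in> sites L p \<Longrightarrow>
      (\<Sum>k\<in>K. C k y * cnj (C' k y')) = (if y = y' then 1 else 0)"
  shows "(\<Sum>ks\<in>incr_tuples N K. bethe N C ks ys * cnj (bethe N C' ks ys')) = (if ys = ys' then 1 else 0)"
proof -
  have "(\<Sum>ks\<in>incr_tuples N K. bethe N C ks ys * cnj (bethe N C' ks ys')) =
      (\<Sum>ks\<in>incr_tuples N K. minor N (\<lambda>y k. C k y) ys ks * minor N (\<lambda>k y. cnj (C' k y)) ks ys')"
    by (simp add: bethe_eq_minor cnj_minor minor_transpose[of N C])
  also have "\<dots> = minor N (\<lambda>y y'. \<Sum>k\<in>K. C k y * cnj (C' k y')) ys ys'"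
    by (rule Cauchy_Binet_minor[OF \<open>finite K\<close>])
  also have "\<dots> = minor N (\<lambda>y y'. if y = y' then 1 else 0) ys ys'"
    by (rule minor_cong[OF ys ys' complete])
  finally show ?thesis by (simp add: minor_delta[OF ys ys'])
qed

section \<open>Eigenvectors of the two-step matrices\<close>

lemma mat_vec_mat_mat:
  "mat_vec I (mat_mat J A B) v i = mat_vec J A (mat_vec I B v) i"
  unfolding mat_vec_def mat_mat_def sum_distrib_left sum_distrib_right
  by (subst sum.swap) (simp add: mult.assoc)

lemma vec_mat_mat_mat:
  "vec_mat I v (mat_mat J A B) j = vec_mat J (vec_mat I v A) B j"
  unfolding vec_mat_def mat_mat_def sum_distrib_left sum_distrib_right
  by (subst sum.swap) (simp add: mult.assoc)

text \<open>One factor carries \<open>u\<close> to a multiple of \<open>v\<close> on the other index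
  set, and the next carries \<open>v\<close> back, each time with the factor
  \<open>c\<close>.\<close>

lemma right_eigenvector_mat_mat:
  assumes "\<exists>i\<in>I. u i \<noteq> 0"
    and "\<And>j. j \<in> J \<Longrightarrow> mat_vec I B u j = c * v j"
    and "\<And>i. i \<in> I \<Longrightarrow> mat_vec J A v i = c * u i"
  shows "right_eigenvector I (mat_mat J A B) u (c\<^sup>2)"
proof -
  have "mat_vec I (mat_mat J A B) u i = c * mat_vec J A v i" for i
    unfolding mat_vec_mat_mat using assms(2)
    by (simp add: mat_vec_def[of J] sum_distrib_left mult_ac)
  then show ?thesis
    using assms(1,3) by (simp add: right_eigenvector_def power2_eq_square)
qed

lemma left_eigenvector_mat_mat:
  assumes "\<exists>i\<in>I. u i \<noteq> 0"
    and "\<And>j. j \<in> J \<Longrightarrow> vec_mat I u A j = c * v j"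
    and "\<And>i. i \<in> I \<Longrightarrow> vec_mat J v B i = c * u i"
  shows "left_eigenvector I (mat_mat J A B) u (c\<^sup>2)"
proof -
  have "vec_mat I u (mat_mat J A B) i = c * vec_mat J v B i" for i
    unfolding vec_mat_mat_mat using assms(2)
    by (simp add: vec_mat_def[of J] sum_distrib_left mult_ac)
  then show ?thesis
    using assms(1,3) by (simp add: left_eigenvector_def power2_eq_square)
qed

section \<open>Eigenvalues and completeness for N walkers\<close>

theorem theorem1:
  fixes L :: int and N :: nat
    and w :: "int \<Rightarrow> int \<Rightarrow> complex"
    and K :: "'k::linorder set"
    and lam :: "'k \<Rightarrow> complex"
    and Rv Lv :: "parity \<Rightarrow> 'k \<Rightarrow> int \<Rightarrow> complex"
  assumes "L > 0" and "odd L" and "N > 1" and "finite K"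
    and R_independent: "\<And>p. inj_on (Rv p) K \<and> cfun.independent (Rv p ` K)"
    and R_span: "\<And>p. cfun.span (Rv p ` K) = cvecs (sites L p)"
    and R_eo: "\<And>k y. k \<in> K \<Longrightarrow> y \<in> sites L Ev \<Longrightarrow>
          mat_vec (sites L Od) (T1 w) (Rv Od k) y = lam k * Rv Ev k y"
    and R_oe: "\<And>k y. k \<in> K \<Longrightarrow> y \<in> sites L Od \<Longrightarrow>
          mat_vec (sites L Ev) (T1 w) (Rv Ev k) y = lam k * Rv Od k y"
    and orthonormal: "\<And>p k k'. k \<in> K \<Longrightarrow> k' \<in> K \<Longrightarrow>
          (\<Sum>y\<in>sites L p. cnj (Lv p k y) * Rv p k' y) = (if k = k' then 1 else 0)"
    and complete: "\<And>p y y'. y \<in> sites L p \<Longrightarrow> y' \<in> sites L p \<Longrightarrow>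
          (\<Sum>k\<in>K. Rv p k y * cnj (Lv p k y')) = (if y = y' then 1 else 0)"
    and L_oe: "\<And>k y. k \<in> K \<Longrightarrow> y \<in> sites L Ev \<Longrightarrow>
          vec_mat (sites L Od) (Lv Od k) (T1 w) y = lam k * Lv Ev k y"
    and L_eo: "\<And>k y. k \<in> K \<Longrightarrow> y \<in> sites L Od \<Longrightarrow>
          vec_mat (sites L Ev) (Lv Ev k) (T1 w) y = lam k * Lv Od k y"
  shows
    "(\<forall>ks \<in> incr_tuples N K.
        (\<forall>ys \<in> configs N L Od. mat_vec (configs N L Ev) (TN N w) (bethe N (Rv Ev) ks) ys
            = Lambda N lam ks * bethe N (Rv Od) ks ys) \<and>
        (\<forall>ys \<in> configs N L Ev. mat_vec (configs N L Od) (TN N w) (bethe N (Rv Od) ks) ys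
            = Lambda N lam ks * bethe N (Rv Ev) ks ys))
   \<and> (\<forall>ks \<in> incr_tuples N K.
        right_eigenvector (configs N L Od) (TN_oo N L w) (bethe N (Rv Od) ks) ((Lambda N lam ks)\<^sup>2) \<and>
        right_eigenvector (configs N L Ev) (TN_ee N L w) (bethe N (Rv Ev) ks) ((Lambda N lam ks)\<^sup>2))
   \<and> (\<forall>p.
        (\<forall>ks \<in> incr_tuples N K. \<forall>ks' \<in> incr_tuples N K.
           (\<Sum>ys\<in>configs N L p. cnj (bethe N (Lv p) ks ys) * bethe N (Rv p) ks' ys)
             = (if ks = ks' then 1 else 0)) \<and>
        (\<forall>ys \<in> configs N L p. \<forall>ys' \<in> configs N L p.
           (\<Sum>ks\<in>incr_tuples N K. bethe N (Rv p) ks ys * cnj (bethe N (Lv p) ks ys'))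
             = (if ys = ys' then 1 else 0)))
   \<and> (\<forall>ks \<in> incr_tuples N K.
        (\<forall>ys \<in> configs N L Ev. vec_mat (configs N L Od) (bethe N (Lv Od) ks) (TN N w) ys
            = Lambda N lam ks * bethe N (Lv Ev) ks ys) \<and>
        (\<forall>ys \<in> configs N L Od. vec_mat (configs N L Ev) (bethe N (Lv Ev) ks) (TN N w) ys
            = Lambda N lam ks * bethe N (Lv Od) ks ys) \<and>
        left_eigenvector (configs N L Od) (TN_oo N L w) (bethe N (Lv Od) ks) ((Lambda N lam ks)\<^sup>2) \<and>
        left_eigenvector (configs N L Ev) (TN_ee N L w) (bethe N (Lv Ev) ks) ((Lambda N lam ks)\<^sup>2))"
proof -
  note R_steps = mat_vec_TN_bethe[OF _ _ R_oe] mat_vec_TN_bethe[OF _ _ R_eo]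
  note L_steps = vec_mat_TN_bethe[OF _ _ L_oe] vec_mat_TN_bethe[OF _ _ L_eo]
  note orth = bethe_orthonormal[OF _ _ orthonormal]
  note compl = bethe_complete[OF \<open>finite K\<close> _ _ complete]
  \<comment> \<open>The pairing of the left and right Bethe vectors of the same index tuple equals
    1, so neither can vanish identically.\<close>
  have nonzero: "(\<exists>ys\<in>configs N L p. bethe N (Rv p) ks ys \<noteq> 0) \<and>
      (\<exists>ys\<in>configs N L p. bethe N (Lv p) ks ys \<noteq> 0)" if "ks \<in> incr_tuples N K" for ks p
  proof -
    have "(\<Sum>ys\<in>configs N L p. cnj (bethe N (Lv p) ks ys) * bethe N (Rv p) ks ys) \<noteq> 0"
      using orth[OF that that, of p] by simp
    then obtain ys where "ys \<in> configs N L p"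
        "cnj (bethe N (Lv p) ks ys) * bethe N (Rv p) ks ys \<noteq> 0"
      by (rule sum.not_neutral_contains_not_neutral)
    then show ?thesis by auto
  qed
  have "right_eigenvector (configs N L Od) (TN_oo N L w) (bethe N (Rv Od) ks) ((Lambda N lam ks)\<^sup>2) \<and>
      right_eigenvector (configs N L Ev) (TN_ee N L w) (bethe N (Rv Ev) ks) ((Lambda N lam ks)\<^sup>2) \<and>
      left_eigenvector (configs N L Od) (TN_oo N L w) (bethe N (Lv Od) ks) ((Lambda N lam ks)\<^sup>2) \<and>
      left_eigenvector (configs N L Ev) (TN_ee N L w) (bethe N (Lv Ev) ks) ((Lambda N lam ks)\<^sup>2)"
    if ks: "ks \<in> incr_tuples N K" for ks
    unfolding TN_oo_def TN_ee_def using nonzero[OF ks]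
    \<comment> \<open>A column vector meets the right factor first and a row vector the left one. On
      odd sites the steps thus start from \<open>R_eo\<close> and \<open>L_oe\<close>, on even sites
      from \<open>R_oe\<close> and \<open>L_eo\<close>, whence the reordered pairs.\<close>
    by (intro conjI right_eigenvector_mat_mat[OF _ R_steps(2,1)[OF ks]]
        right_eigenvector_mat_mat[OF _ R_steps[OF ks]]
        left_eigenvector_mat_mat[OF _ L_steps[OF ks]]
        left_eigenvector_mat_mat[OF _ L_steps(2,1)[OF ks]]) blast+
  then show ?thesis
    by (intro conjI ballI allI R_steps L_steps orth compl) blast+
qed

end
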